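(* Let $\eta$ be a Borel probability measure on $\mathbb{R}^d$ and suppose $F\in L^p_\eta(\mathbb{R}^d;\mathbb{R}^m)$ for some $1\le p<\infty$. Then, for any $\epsilon>0$, there exist a number $n=n(\epsilon)\in\mathbb{N}$ and a four-layer ReLU neural network $\widehat{F}:\mathbb{R}^d\to\mathbb{R}^m$ with $n$ parameters such that $$\|F-\widehat{F}\|_{L^p_\eta}<\epsilon.$$
   Context: $\|f\|_{L^p_\eta}=(\int_{\mathbb{R}^d}|f|^p\,d\eta)^{1/p}$ with $|\cdot|$ the Euclidean norm. A ReLU neural network with $L$ layers is a map of the form $A_{L+1}\circ\sigma\circ A_L\circ\cdots\circ\sigma\circ A_1$, where the $A_i$ are affine maps between finite-dimensional Euclidean spaces (of arbitrary widths) and $\sigma(t)=\max(t,0)$ is applied componentwise; thus layers are counted as hidden layers. Its number of parameters is the number of weights and biases of the affine maps. *)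

theory Defs
  imports "HOL-Probability.Probability"
begin

definition Lp_space :: "real \<Rightarrow> 'a measure \<Rightarrow> ('a \<Rightarrow> 'b::euclidean_space) set" where
  "Lp_space p M = {f. f \<in> borel_measurable M \<and> integrable M (\<lambda>x. norm (f x) powr p)}"

text \<open>Only meaningful for members of \<open>Lp_space p M\<close>: the Bochner integral of a
  non-integrable function is \<open>0\<close>.\<close>

definition Lp_norm :: "real \<Rightarrow> 'a measure \<Rightarrow> ('a \<Rightarrow> 'b::euclidean_space) \<Rightarrow> real" where
  "Lp_norm p M f = (\<integral>x. norm (f x) powr p \<partial>M) powr (1 / p)"

text \<open>Hidden layers have widths that cannot be types, so a vector in a hidden space of
  dimension \<open>k\<close> is a function \<open>nat \<Rightarrow> real\<close> whose coordinates are the arguments \<open>i < k\<close>;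
  the values at \<open>i \<ge> k\<close> are junk, and \<open>affine_map {..<k}\<close> never reads them.
  Input and output are indexed by the finite types of \<open>real ^ 'd\<close> and \<open>real ^ 'm\<close>.\<close>

definition affine_map ::
    "'i set \<Rightarrow> ('o \<Rightarrow> 'i \<Rightarrow> real) \<Rightarrow> ('o \<Rightarrow> real) \<Rightarrow> ('i \<Rightarrow> real) \<Rightarrow> ('o \<Rightarrow> real)" where
  "affine_map I W b x = (\<lambda>j. (\<Sum>i\<in>I. W j i * x i) + b j)"

definition relu :: "('i \<Rightarrow> real) \<Rightarrow> ('i \<Rightarrow> real)" where
  "relu x = (\<lambda>i. max (x i) 0)"

text \<open>\<open>relu_hidden L k n g\<close>: \<open>g\<close> is of the form \<open>\<sigma> \<circ> A\<^sub>L \<circ> \<dots> \<circ> \<sigma> \<circ> A\<^sub>1\<close> with last width \<open>k\<close>,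
  and \<open>A\<^sub>1, \<dots>, A\<^sub>L\<close> have \<open>n\<close> weights and biases in total. Every entry of a weight
  matrix counts as a parameter, whether or not it is zero.\<close>

inductive relu_hidden :: "nat \<Rightarrow> nat \<Rightarrow> nat \<Rightarrow> (real ^ 'd \<Rightarrow> nat \<Rightarrow> real) \<Rightarrow> bool" where
  first: "k \<ge> 1 \<Longrightarrow>
    relu_hidden 1 k (k * CARD('d) + k) (\<lambda>x :: real ^ 'd. relu (affine_map UNIV W b (\<lambda>i. x $ i)))"
| step: "relu_hidden L j n g \<Longrightarrow> k \<ge> 1 \<Longrightarrow>
    relu_hidden (Suc L) k (n + (k * j + k)) (\<lambda>x. relu (affine_map {..<j} W b (g x)))"

text \<open>\<open>F\<close> is realised by a ReLU network with \<open>L \<ge> 1\<close> hidden layers and exactly \<open>n\<close> parameters.\<close>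

definition relu_network :: "nat \<Rightarrow> nat \<Rightarrow> (real ^ 'd \<Rightarrow> real ^ 'm) \<Rightarrow> bool" where
  "relu_network L n F \<longleftrightarrow>
    (\<exists>k q g W b. relu_hidden L k q g \<and> n = q + (CARD('m) * k + CARD('m)) \<and>
      F = (\<lambda>x. \<chi> j. affine_map {..<k} W b (g x) j))"

end

theory Submission
  imports Defs
begin

text \<open>
  On a space of finite measure, \<open>L\<^sup>p\<close> approximation reduces to indicators of a generating
  family. Dominated convergence reduces a function in \<open>L\<^sup>p\<close> to simple functions, hence to
  indicators of measurable sets times vectors. The measurable sets whose indicators can be
  approximated by a class \<open>S\<close> that is closed under addition form a Dynkin system once
  constants can be approximated, so it is enough to treat an intersection-stable generator
  (\<open>Lp_space_subset_Lp_closure\<close>).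

  The Borel sets of \<open>real ^ 'd\<close> are generated by the closed lower orthants \<open>{..a}\<close>, and the
  indicator of such an orthant is the pointwise limit, as \<open>c \<rightarrow> \<infinity>\<close>, of
  \<open>max (1 - c * (\<Sum>i. max (x $ i - a $ i) 0)) 0\<close>: the inner sum measures by how much \<open>x\<close> leaves
  the orthant and vanishes exactly on it. All values lie between \<open>0\<close> and \<open>1\<close>, so the
  convergence is dominated. Linear combinations of these bumps are therefore dense
  (\<open>bump_sum_dense\<close>).

  Each bump is by its very form a ReLU expression of depth two: one neuron per coordinate in the first
  hidden layer and one in the second. A linear combination of bumps puts these networks side
  by side (\<open>corner_bumps_relu_hidden\<close>). Two hidden layers suffice, and the others carry the
  values along unchanged, because ReLU fixes nonnegative numbers (\<open>relu_hidden_deepen\<close>).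
\<close>

section \<open>Approximation in the mean of order p\<close>

text \<open>The error is measured by the integral of the \<open>p\<close>-th power, without the root, so that
  the elementary inequality \<open>norm_add_powr_le\<close> can stand in for Minkowski's.\<close>

definition Lp_closure ::
    "real \<Rightarrow> 'a measure \<Rightarrow> ('a \<Rightarrow> 'b::euclidean_space) set \<Rightarrow> ('a \<Rightarrow> 'b) set" where
  "Lp_closure p M S = {f. \<forall>\<epsilon>>0. \<exists>g\<in>S. (\<lambda>x. f x - g x) \<in> Lp_space p M \<and>
     (\<integral>x. norm (f x - g x) powr p \<partial>M) < \<epsilon>}"

lemma norm_add_powr_le:
  fixes u v :: "'b::real_normed_vector"
  assumes "0 < p"
  shows "norm (u + v) powr p \<le> 2 powr p * (norm u powr p + norm v powr p)"
proof -
  have "norm (u + v) \<le> 2 * max (norm u) (norm v)"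
    using norm_triangle_ineq[of u v] by linarith
  then have "norm (u + v) powr p \<le> (2 * max (norm u) (norm v)) powr p"
    using assms by (intro powr_mono2) auto
  also have "\<dots> = 2 powr p * max (norm u) (norm v) powr p"
    by (rule powr_mult)
  also have "\<dots> \<le> 2 powr p * (norm u powr p + norm v powr p)"
    by (intro mult_left_mono) (auto simp: max_def)
  finally show ?thesis .
qed

lemma Lp_space_add:
  assumes p: "0 < p" and f: "f \<in> Lp_space p M" and g: "g \<in> Lp_space p M"
  shows "(\<lambda>x. f x + g x) \<in> Lp_space p M"
    and "(\<integral>x. norm (f x + g x) powr p \<partial>M) \<le>
      2 powr p * ((\<integral>x. norm (f x) powr p \<partial>M) + (\<integral>x. norm (g x) powr p \<partial>M))"
proof -
  have [measurable]: "f \<in> borel_measurable M" "g \<in> borel_measurable M"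
    and int: "integrable M (\<lambda>x. norm (f x) powr p)" "integrable M (\<lambda>x. norm (g x) powr p)"
    using f g by (auto simp: Lp_space_def)
  let ?B = "\<lambda>x. 2 powr p * (norm (f x) powr p + norm (g x) powr p)"
  have B: "integrable M ?B" using int by simp
  have sum: "integrable M (\<lambda>x. norm (f x + g x) powr p)"
    by (rule Bochner_Integration.integrable_bound[OF B])
      (use norm_add_powr_le[OF p] in \<open>auto intro!: AE_I2\<close>)
  then show "(\<lambda>x. f x + g x) \<in> Lp_space p M" by (simp add: Lp_space_def)
  have "(\<integral>x. norm (f x + g x) powr p \<partial>M) \<le> (\<integral>x. ?B x \<partial>M)"
    by (rule integral_mono[OF sum B]) (rule norm_add_powr_le[OF p])
  also have "\<dots> = 2 powr p * ((\<integral>x. norm (f x) powr p \<partial>M) + (\<integral>x. norm (g x) powr p \<partial>M))"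
    using int by simp
  finally show "(\<integral>x. norm (f x + g x) powr p \<partial>M) \<le>
      2 powr p * ((\<integral>x. norm (f x) powr p \<partial>M) + (\<integral>x. norm (g x) powr p \<partial>M))" .
qed

lemma Lp_space_add_small:
  assumes p: "0 < p" and "f \<in> Lp_space p M" "g \<in> Lp_space p M"
    and "(\<integral>x. norm (f x) powr p \<partial>M) < \<epsilon> / (2 * 2 powr p)"
    and "(\<integral>x. norm (g x) powr p \<partial>M) < \<epsilon> / (2 * 2 powr p)"
  shows "(\<integral>x. norm (f x + g x) powr p \<partial>M) < \<epsilon>"
proof -
  have "(\<integral>x. norm (f x + g x) powr p \<partial>M) \<le>
      2 powr p * ((\<integral>x. norm (f x) powr p \<partial>M) + (\<integral>x. norm (g x) powr p \<partial>M))"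
    using Lp_space_add(2)[OF assms(1-3)] .
  also have "\<dots> < 2 powr p * (\<epsilon> / (2 * 2 powr p) + \<epsilon> / (2 * 2 powr p))"
    using assms(4,5) by (intro mult_strict_left_mono add_strict_mono) auto
  also have "\<dots> = \<epsilon>" by (simp add: field_simps)
  finally show ?thesis .
qed

lemma Lp_closure_add:
  assumes p: "0 < p" and S: "\<And>f g. f \<in> S \<Longrightarrow> g \<in> S \<Longrightarrow> (\<lambda>x. f x + g x) \<in> S"
    and f: "f \<in> Lp_closure p M S" and g: "g \<in> Lp_closure p M S"
  shows "(\<lambda>x. f x + g x) \<in> Lp_closure p M S"
  unfolding Lp_closure_def mem_Collect_eq
proof (intro allI impI)
  fix \<epsilon> :: real assume "\<epsilon> > 0"
  then have "\<epsilon> / (2 * 2 powr p) > 0" by simp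
  then obtain f' g' where f': "f' \<in> S" "(\<lambda>x. f x - f' x) \<in> Lp_space p M"
      "(\<integral>x. norm (f x - f' x) powr p \<partial>M) < \<epsilon> / (2 * 2 powr p)"
    and g': "g' \<in> S" "(\<lambda>x. g x - g' x) \<in> Lp_space p M"
      "(\<integral>x. norm (g x - g' x) powr p \<partial>M) < \<epsilon> / (2 * 2 powr p)"
    using f g unfolding Lp_closure_def by blast
  have eq: "(f x - f' x) + (g x - g' x) = (f x + g x) - (f' x + g' x)" for x
    by simp
  show "\<exists>h\<in>S. (\<lambda>x. f x + g x - h x) \<in> Lp_space p M \<and>
      (\<integral>x. norm (f x + g x - h x) powr p \<partial>M) < \<epsilon>"
    using S[OF f'(1) g'(1)] Lp_space_add(1)[OF p f'(2) g'(2)]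
      Lp_space_add_small[OF p f'(2) g'(2) f'(3) g'(3)]
    unfolding eq by (intro bexI[of _ "\<lambda>x. f' x + g' x"] conjI) assumption+
qed

text \<open>Approximation may be done in stages: this is what allows each limit process below to
  start from functions that are themselves only approximated by members of \<open>S\<close>.\<close>

lemma Lp_closure_idem:
  assumes p: "0 < p"
  shows "Lp_closure p M (Lp_closure p M S) \<subseteq> Lp_closure p M S"
proof
  fix f assume f: "f \<in> Lp_closure p M (Lp_closure p M S)"
  show "f \<in> Lp_closure p M S"
    unfolding Lp_closure_def mem_Collect_eq
  proof (intro allI impI)
    fix \<epsilon> :: real assume "\<epsilon> > 0"
    then have pos: "\<epsilon> / (2 * 2 powr p) > 0" by simp
    then obtain g where g: "g \<in> Lp_closure p M S" "(\<lambda>x. f x - g x) \<in> Lp_space p M"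
        "(\<integral>x. norm (f x - g x) powr p \<partial>M) < \<epsilon> / (2 * 2 powr p)"
      using f unfolding Lp_closure_def[of p M "Lp_closure p M S"] by blast
    obtain h where h: "h \<in> S" "(\<lambda>x. g x - h x) \<in> Lp_space p M"
        "(\<integral>x. norm (g x - h x) powr p \<partial>M) < \<epsilon> / (2 * 2 powr p)"
      using g(1) pos unfolding Lp_closure_def by blast
    have eq: "(f x - g x) + (g x - h x) = f x - h x" for x by simp
    show "\<exists>h\<in>S. (\<lambda>x. f x - h x) \<in> Lp_space p M \<and>
        (\<integral>x. norm (f x - h x) powr p \<partial>M) < \<epsilon>"
      using h(1) Lp_space_add(1)[OF p g(2) h(2)] Lp_space_add_small[OF p g(2) h(2) g(3) h(3)]
      unfolding eq by blast
  qed
qed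

text \<open>The only source of approximations in this development. The bound \<open>w\<close> dominates the
  errors rather than the functions \<open>s k\<close>; with \<open>w = 0\<close> the lemma says that values outside
  \<open>space M\<close> do not matter.\<close>

lemma Lp_closure_dominated_limit:
  fixes f :: "'a \<Rightarrow> 'b::euclidean_space"
  assumes p: "0 < p"
    and S: "\<And>k. s k \<in> S" and [measurable]: "\<And>k. s k \<in> borel_measurable M"
    and lim: "\<And>x. x \<in> space M \<Longrightarrow> (\<lambda>k. s k x) \<longlonglongrightarrow> f x"
    and w: "integrable M (\<lambda>x. w x powr p)"
    and bound: "\<And>k x. x \<in> space M \<Longrightarrow> norm (f x - s k x) \<le> w x"
  shows "f \<in> Lp_closure p M S"
  unfolding Lp_closure_def mem_Collect_eq
proof (intro allI impI)
  fix \<epsilon> :: real assume "\<epsilon> > 0"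
  have [measurable]: "f \<in> borel_measurable M"
    by (rule borel_measurable_LIMSEQ_metric[of s]) (auto intro: lim)
  have dom: "norm (norm (f x - s k x) powr p) \<le> w x powr p" if "x \<in> space M" for k x
    using bound[OF that, of k] p by (auto intro: powr_mono2)
  have int: "integrable M (\<lambda>x. norm (f x - s k x) powr p)" for k
    by (rule Bochner_Integration.integrable_bound[OF w])
      (use dom in \<open>auto intro!: AE_I2\<close>)
  have "(\<lambda>k. \<integral>x. norm (f x - s k x) powr p \<partial>M) \<longlonglongrightarrow> (\<integral>x. 0 \<partial>M)"
  proof (rule integral_dominated_convergence[OF _ _ w])
    show "AE x in M. (\<lambda>k. norm (f x - s k x) powr p) \<longlonglongrightarrow> 0"
    proof (rule AE_I2)
      fix x assume "x \<in> space M"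
      have "(\<lambda>k. f x - s k x) \<longlonglongrightarrow> f x - f x"
        by (intro tendsto_intros lim[OF \<open>x \<in> space M\<close>])
      then have "(\<lambda>k. norm (f x - s k x)) \<longlonglongrightarrow> 0"
        by (simp add: tendsto_norm_zero)
      then show "(\<lambda>k. norm (f x - s k x) powr p) \<longlonglongrightarrow> 0"
        by (rule tendsto_zero_powrI[OF _ tendsto_const]) (use p in auto)
    qed
  qed (use dom in \<open>auto intro!: AE_I2\<close>)
  then have "\<forall>\<^sub>F k in sequentially. (\<integral>x. norm (f x - s k x) powr p \<partial>M) < \<epsilon>"
    using \<open>\<epsilon> > 0\<close> by (intro order_tendstoD(2)) auto
  then obtain k where "(\<integral>x. norm (f x - s k x) powr p \<partial>M) < \<epsilon>"
    by (meson eventually_sequentially order_refl)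
  then show "\<exists>g\<in>S. (\<lambda>x. f x - g x) \<in> Lp_space p M \<and>
      (\<integral>x. norm (f x - g x) powr p \<partial>M) < \<epsilon>"
    using S[of k] int[of k] by (intro bexI[of _ "s k"]) (auto simp: Lp_space_def)
qed

section \<open>Density from a generating intersection-stable family\<close>

text \<open>Dynkin's \<open>\<pi>\<close>-\<open>\<lambda>\<close> argument. The vector \<open>v\<close> varies in the induction: a complement is
  the constant \<open>v\<close> plus an indicator times \<open>- v\<close>, which is a sum of two
  functions already approximated. Disjointness turns finite unions into finite sums, and
  countable unions are then limits dominated by the constant \<open>norm v\<close>, whose \<open>p\<close>-th power is
  integrable because the measure is finite.\<close>

lemma indicator_in_Lp_closure:
  fixes v :: "'b::euclidean_space"
  assumes "finite_measure M" and p: "0 < p"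
    and G: "G \<subseteq> Pow (space M)" "Int_stable G" "sets M = sigma_sets (space M) G"
    and S: "\<And>f g. f \<in> S \<Longrightarrow> g \<in> S \<Longrightarrow> (\<lambda>x. f x + g x) \<in> S"
    and const: "\<And>v. (\<lambda>x. v) \<in> Lp_closure p M S"
    and basic: "\<And>A v. A \<in> G \<Longrightarrow> (\<lambda>x. indicator A x *\<^sub>R v) \<in> Lp_closure p M S"
    and A: "A \<in> sets M"
  shows "(\<lambda>x. indicator A x *\<^sub>R v) \<in> Lp_closure p M S"
proof -
  interpret finite_measure M by fact
  have add: "(\<lambda>x. f x + g x) \<in> Lp_closure p M S"
    if "f \<in> Lp_closure p M S" "g \<in> Lp_closure p M S" for f g
    by (rule Lp_closure_add[OF p S that])
  have "A \<in> sigma_sets (space M) G" using A G(3) by simp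
  from G(2,1) this show ?thesis
  proof (induction arbitrary: v rule: sigma_sets_induct_disjoint)
    case (basic A)
    then show ?case by (rule assms)
  next
    case empty
    show ?case using const[of 0] by simp
  next
    case (compl A)
    have A: "A \<in> sets M" using compl G by simp
    let ?h = "\<lambda>x. v + indicator A x *\<^sub>R (- v)"
    have h: "?h \<in> Lp_closure p M S"
      by (rule add[OF const[of v] compl(2)[of "- v"]])
    \<comment> \<open>The two functions agree on \<open>space M\<close> only, so a constant sequence with zero error
      bound transfers membership from one to the other.\<close>
    have "(\<lambda>x. indicator (space M - A) x *\<^sub>R v) \<in> Lp_closure p M (Lp_closure p M S)"
      by (rule Lp_closure_dominated_limit[where s = "\<lambda>k. ?h" and w = "\<lambda>x. 0"])
        (use p h A in \<open>auto simp: indicator_def\<close>)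
    then show ?case using Lp_closure_idem[OF p] by blast
  next
    case (union A)
    have A: "A i \<in> sets M" for i using union(2) G(3) by auto
    let ?s = "\<lambda>k x. \<Sum>i<k. indicator (A i) x *\<^sub>R v"
    have s: "?s k \<in> Lp_closure p M S" for k
    proof (induction k)
      case 0
      show ?case using const[of 0] by simp
    next
      case (Suc k)
      show ?case using add[OF Suc union(3)[of k v]] by simp
    qed
    have s_eq: "?s k x = indicator (\<Union>i<k. A i) x *\<^sub>R v" for k x
    proof -
      have "disjoint_family_on A {..<k}"
        using union(1) by (auto simp: disjoint_family_on_def)
      then show ?thesis
        by (simp add: scaleR_left.sum[symmetric] indicator_UN_disjoint)
    qed
    have "(\<lambda>x. indicator (\<Union>i. A i) x *\<^sub>R v) \<in> Lp_closure p M (Lp_closure p M S)"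
    proof (rule Lp_closure_dominated_limit[OF p s])
      fix x
      have "(\<lambda>k. indicator (\<Union>i<k. A i) x :: real) \<longlonglongrightarrow> indicator (\<Union>i. A i) x"
        by (rule LIMSEQ_indicator_UN)
      then show "(\<lambda>k. ?s k x) \<longlonglongrightarrow> indicator (\<Union>i. A i) x *\<^sub>R v"
        unfolding s_eq by (intro tendsto_intros)
    next
      show "integrable M (\<lambda>x. norm v powr p)" by simp
    next
      fix k x
      show "norm (indicator (\<Union>i. A i) x *\<^sub>R v - ?s k x) \<le> norm v"
        unfolding s_eq by (auto simp: indicator_def)
    qed (use A in measurable)
    then show ?case using Lp_closure_idem[OF p] by blast
  qed
qed

text \<open>Every measurable function is a pointwise limit of simple functions bounded by twice its
  norm, and a simple function is a finite sum of indicators times vectors. The error is then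
  dominated by \<open>3 * norm (f x)\<close>, which has an integrable \<open>p\<close>-th power.\<close>

theorem Lp_space_subset_Lp_closure:
  fixes S :: "('a \<Rightarrow> 'b::euclidean_space) set"
  assumes M: "finite_measure M" and p: "0 < p"
    and G: "G \<subseteq> Pow (space M)" "Int_stable G" "sets M = sigma_sets (space M) G"
    and S: "\<And>f g. f \<in> S \<Longrightarrow> g \<in> S \<Longrightarrow> (\<lambda>x. f x + g x) \<in> S"
    and const: "\<And>v. (\<lambda>x. v) \<in> Lp_closure p M S"
    and basic: "\<And>A v. A \<in> G \<Longrightarrow> (\<lambda>x. indicator A x *\<^sub>R v) \<in> Lp_closure p M S"
  shows "Lp_space p M \<subseteq> Lp_closure p M S"
proof
  fix f :: "'a \<Rightarrow> 'b" assume "f \<in> Lp_space p M"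
  then have [measurable]: "f \<in> borel_measurable M"
    and int: "integrable M (\<lambda>x. norm (f x) powr p)"
    by (auto simp: Lp_space_def)
  obtain s where s_raw: "\<forall>k. simple_function M (s k)"
    "\<forall>x\<in>space M. (\<lambda>k. s k x) \<longlonglongrightarrow> f x"
    "\<forall>k. \<forall>x\<in>space M. dist (s k x) 0 \<le> 2 * dist (f x) 0"
    using borel_measurable_implies_sequence_metric[OF \<open>f \<in> borel_measurable M\<close>, of 0]
    by (elim exE conjE) (rule that)
  note s = s_raw(1)[rule_format] s_raw(2)[rule_format] s_raw(3)[rule_format]
  have add: "(\<lambda>x. g x + h x) \<in> Lp_closure p M S"
    if "g \<in> Lp_closure p M S" "h \<in> Lp_closure p M S" for g h
    by (rule Lp_closure_add[OF p S that])
  define t where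
    "t k x = (\<Sum>y\<in>s k ` space M. indicator (s k -` {y} \<inter> space M) x *\<^sub>R y)" for k x
  have fin: "finite (s k ` space M)" for k
    using simple_functionD(1)[OF s(1)] .
  have [measurable]: "s k -` {y} \<inter> space M \<in> sets M" for k y
    using simple_functionD(2)[OF s(1)] .
  have t_eq: "t k x = s k x" if "x \<in> space M" for k x
  proof -
    have "t k x = (\<Sum>y\<in>s k ` space M. if y = s k x then y else 0)"
      unfolding t_def using that by (intro sum.cong) (auto simp: indicator_def)
    then show ?thesis using that fin by simp
  qed
  have t: "t k \<in> Lp_closure p M S" for k
  proof -
    have "(\<lambda>x. \<Sum>y\<in>Y. indicator (s k -` {y} \<inter> space M) x *\<^sub>R y) \<in> Lp_closure p M S"
      if "finite Y" for Y
      using that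
    proof (induction Y)
      case empty
      show ?case using const[of 0] by simp
    next
      case (insert y Y)
      have "(\<lambda>x. indicator (s k -` {y} \<inter> space M) x *\<^sub>R y) \<in> Lp_closure p M S"
        by (rule indicator_in_Lp_closure[OF M p G S const basic]) auto
      then have "(\<lambda>x. indicator (s k -` {y} \<inter> space M) x *\<^sub>R y +
          (\<Sum>y\<in>Y. indicator (s k -` {y} \<inter> space M) x *\<^sub>R y)) \<in> Lp_closure p M S"
        by (rule add[OF _ insert.IH])
      then show ?case unfolding sum.insert[OF insert.hyps] .
    qed
    from this[OF fin[of k]] show ?thesis unfolding t_def[abs_def] .
  qed
  have "f \<in> Lp_closure p M (Lp_closure p M S)"
  proof (rule Lp_closure_dominated_limit[OF p t, where w = "\<lambda>x. 3 * norm (f x)"])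
    show "t k \<in> borel_measurable M" for k
      unfolding t_def[abs_def] by measurable
    show "(\<lambda>k. t k x) \<longlonglongrightarrow> f x" if "x \<in> space M" for x
      using s(2)[OF that] by (simp add: t_eq[OF that])
    show "integrable M (\<lambda>x. (3 * norm (f x)) powr p)"
      using int by (simp add: powr_mult)
    show "norm (f x - t k x) \<le> 3 * norm (f x)" if "x \<in> space M" for k x
      using s(3)[OF that, of k] norm_triangle_ineq4[of "f x" "s k x"]
      by (simp add: t_eq[OF that])
  qed
  then show "f \<in> Lp_closure p M S" using Lp_closure_idem[OF p] by blast
qed

section \<open>Continuous approximations of orthant indicators\<close>

text \<open>Equal to \<open>1\<close> on the orthant \<open>{..a}\<close>; outside it falls linearly with slope \<open>c\<close> in each
  coordinate until it reaches \<open>0\<close>. For \<open>c = 0\<close> it is the constant \<open>1\<close>, which provides the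
  constant functions.\<close>

definition corner_bump :: "real \<Rightarrow> real ^ 'd \<Rightarrow> real ^ 'd \<Rightarrow> real" where
  "corner_bump c a x = max (1 - c * (\<Sum>i\<in>UNIV. max (x $ i - a $ i) 0)) 0"

text \<open>Linear combinations are encoded by lists so that addition is concatenation and the
  position in the list can serve as the index of a neuron.\<close>

definition bump_sum :: "(real \<times> (real ^ 'd) \<times> 'b) list \<Rightarrow> real ^ 'd \<Rightarrow> 'b::euclidean_space" where
  "bump_sum ts x = (\<Sum>(c, a, v)\<leftarrow>ts. corner_bump c a x *\<^sub>R v)"

lemma bump_sum_append: "bump_sum (ts @ us) x = bump_sum ts x + bump_sum us x"
  by (simp add: bump_sum_def)

lemma corner_bump_measurable [measurable]: "corner_bump c a \<in> borel_measurable borel"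
  unfolding corner_bump_def[abs_def] by measurable

lemma corner_bump_bounds:
  assumes "c \<ge> 0"
  shows "0 \<le> corner_bump c a x" "corner_bump c a x \<le> 1"
proof -
  have "0 \<le> c * (\<Sum>i\<in>UNIV. max (x $ i - a $ i) 0)"
    using assms by (intro mult_nonneg_nonneg sum_nonneg) auto
  then show "0 \<le> corner_bump c a x" "corner_bump c a x \<le> 1"
    by (auto simp: corner_bump_def)
qed

text \<open>The excess \<open>e\<close> of \<open>x\<close> over \<open>a\<close> is zero iff \<open>x \<le> a\<close>. Where it is positive, the bump is
  exactly zero as soon as \<open>k * e > 1\<close>.\<close>

lemma corner_bump_tendsto_indicator:
  fixes a x :: "real ^ 'd"
  shows "(\<lambda>k. corner_bump (real k) a x) \<longlonglongrightarrow> indicator {..a} x"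
proof -
  define e where "e = (\<Sum>i\<in>UNIV. max (x $ i - a $ i) 0)"
  have e_nonneg: "e \<ge> 0" unfolding e_def by (intro sum_nonneg) auto
  have "e = 0 \<longleftrightarrow> (\<forall>i. max (x $ i - a $ i) 0 = 0)"
    unfolding e_def by (subst sum_nonneg_eq_0_iff) auto
  also have "\<dots> \<longleftrightarrow> x \<le> a"
    unfolding less_eq_vec_def by (metis diff_le_0_iff_le max.absorb2 max.cobounded1)
  finally have e_zero: "e = 0 \<longleftrightarrow> x \<le> a" .
  show ?thesis
  proof (cases "x \<le> a")
    case True
    then show ?thesis using e_zero by (simp add: corner_bump_def flip: e_def)
  next
    case False
    then have "e > 0" using e_zero e_nonneg by simp
    obtain K where K: "1 < real K * e"
      using reals_Archimedean3[OF \<open>e > 0\<close>] by blast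
    have "\<forall>\<^sub>F k in sequentially. corner_bump (real k) a x = 0"
      using eventually_ge_at_top[of K]
    proof eventually_elim
      case (elim k)
      then have "real K * e \<le> real k * e" using e_nonneg by (intro mult_right_mono) auto
      then show ?case using K by (simp add: corner_bump_def flip: e_def)
    qed
    then show ?thesis using False by (simp add: tendsto_eventually)
  qed
qed

theorem bump_sum_dense:
  fixes M :: "(real ^ 'd) measure"
  assumes "finite_measure M" and M: "sets M = sets borel" and p: "0 < p"
  shows "Lp_space p M \<subseteq> Lp_closure p M (range (bump_sum :: _ \<Rightarrow> _ \<Rightarrow> 'b::euclidean_space))"
proof -
  interpret finite_measure M by fact
  have space: "space M = UNIV" using sets_eq_imp_space_eq[OF M] by simp
  have [measurable]: "corner_bump c a \<in> borel_measurable M" for c and a :: "real ^ 'd"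
    using corner_bump_measurable M by (simp cong: measurable_cong_sets)
  have single: "(\<lambda>x. corner_bump c a x *\<^sub>R v) \<in> range bump_sum" for c and a :: "real ^ 'd" and v :: 'b
    by (rule image_eqI[of _ _ "[(c, a, v)]"]) (auto simp: bump_sum_def)
  show ?thesis
  proof (rule Lp_space_subset_Lp_closure[where G = "range (\<lambda>a::real ^ 'd. {..a})"])
    show "finite_measure M" "0 < p" by fact+
    show "range (\<lambda>a::real ^ 'd. {..a}) \<subseteq> Pow (space M)" by (simp add: space)
    show "Int_stable (range (\<lambda>a::real ^ 'd. {..a}))"
    proof (rule Int_stableI_image)
      fix a b :: "real ^ 'd"
      show "\<exists>c\<in>UNIV. {..a} \<inter> {..b} = {..c}" by (intro bexI[of _ "inf a b"]) auto
    qed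
    show "sets M = sigma_sets (space M) (range (\<lambda>a::real ^ 'd. {..a}))"
      unfolding M space by (subst borel_eq_atMost) simp
  next
    fix f g :: "real ^ 'd \<Rightarrow> 'b"
    assume "f \<in> range bump_sum" "g \<in> range bump_sum"
    then obtain ts us where "f = bump_sum ts" "g = bump_sum us" by blast
    then show "(\<lambda>x. f x + g x) \<in> range bump_sum"
      by (intro image_eqI[of _ _ "ts @ us"]) (auto simp: bump_sum_append)
  next
    fix v :: 'b
    have "(\<lambda>x::real ^ 'd. v) \<in> range bump_sum"
      using single[of 0 0 v] by (simp add: corner_bump_def)
    then show "(\<lambda>x. v) \<in> Lp_closure p M (range bump_sum)"
      by (rule Lp_closure_dominated_limit[where s = "\<lambda>k x. v" and w = "\<lambda>x. 0", OF p]) auto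
  next
    fix A and v :: 'b assume "A \<in> range (\<lambda>a::real ^ 'd. {..a})"
    then obtain a where A: "A = {..a}" by blast
    show "(\<lambda>x. indicator A x *\<^sub>R v) \<in> Lp_closure p M (range bump_sum)"
      unfolding A
    proof (rule Lp_closure_dominated_limit[OF p single])
      fix x
      show "(\<lambda>k. corner_bump (real k) a x *\<^sub>R v) \<longlonglongrightarrow> indicator {..a} x *\<^sub>R v"
        by (intro tendsto_intros corner_bump_tendsto_indicator)
    next
      show "integrable M (\<lambda>x. norm v powr p)" by simp
    next
      fix k x
      have "\<bar>indicator {..a} x - corner_bump (real k) a x\<bar> \<le> 1"
        using corner_bump_bounds[of "real k" a x] by (auto simp: indicator_def)
      then have "\<bar>indicator {..a} x - corner_bump (real k) a x\<bar> * norm v \<le> 1 * norm v"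
        by (intro mult_right_mono) auto
      then show "norm (indicator {..a} x *\<^sub>R v - corner_bump (real k) a x *\<^sub>R v) \<le> norm v"
        by (simp flip: scaleR_left_diff_distrib)
    qed measurable
  qed
qed

section \<open>Realisation by ReLU networks\<close>

lemma relu_hidden_nonneg: "relu_hidden L k n g \<Longrightarrow> 0 \<le> g x j"
  by (induction rule: relu_hidden.induct) (auto simp: relu_def)

lemma relu_hidden_width_pos: "relu_hidden L k n g \<Longrightarrow> k \<ge> 1"
  by (induction rule: relu_hidden.induct) auto

text \<open>The output of a hidden layer is nonnegative, so a further layer with the identity matrix
  and zero bias reproduces it. The identity layer reads only the first \<open>k\<close> coordinates and
  sets the junk beyond them to zero, hence the agreement is stated for \<open>j < k\<close> only.\<close>

lemma relu_hidden_deepen: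
  assumes "relu_hidden L k n g"
  shows "\<exists>n' g'. relu_hidden (L + m) k n' g' \<and> (\<forall>x. \<forall>j<k. g' x j = g x j)"
proof (induction m)
  case 0
  show ?case using assms by auto
next
  case (Suc m)
  then obtain n' g' where g': "relu_hidden (L + m) k n' g'" "\<And>x j. j < k \<Longrightarrow> g' x j = g x j"
    by blast
  let ?h = "\<lambda>x. relu (affine_map {..<k} (\<lambda>j i. if i = j then 1 else 0) (\<lambda>j. 0) (g' x))"
  have "relu_hidden (Suc (L + m)) k (n' + (k * k + k)) ?h"
    by (rule relu_hidden.step[OF g'(1) relu_hidden_width_pos[OF assms]])
  moreover have "?h x j = g x j" if "j < k" for x j
  proof -
    have "affine_map {..<k} (\<lambda>j i. if i = j then 1 else 0) (\<lambda>j. 0) (g' x) j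
        = (\<Sum>i<k. if i = j then g' x i else 0)"
      unfolding affine_map_def by (subst add_0_right) (rule sum.cong, auto)
    also have "\<dots> = g x j" using that g'(2) by simp
    finally show ?thesis using relu_hidden_nonneg[OF assms, of x j] by (simp add: relu_def)
  qed
  ultimately show ?case unfolding add_Suc_right by blast
qed

text \<open>The first hidden layer has one neuron for each pair of a bump \<open>r\<close> and a coordinate
  \<open>i\<close>, computing \<open>max (x $ i - a r $ i) 0\<close>; the second has one neuron per bump, summing with
  weight \<open>- c r\<close> over the pairs that belong to it. The bijection \<open>\<phi>\<close> numbers the pairs, as
  neurons are indexed by natural numbers while coordinates live in a finite type.\<close>

lemma corner_bumps_relu_hidden:
  fixes c :: "nat \<Rightarrow> real" and a :: "nat \<Rightarrow> real ^ 'd"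
  assumes "N \<ge> 1"
  shows "\<exists>n g. relu_hidden 2 N n g \<and> (\<forall>x. \<forall>r<N. g x r = corner_bump (c r) (a r) x)"
proof -
  define K where "K = card ({..<N} \<times> (UNIV :: 'd set))"
  obtain \<phi> where \<phi>: "bij_betw \<phi> {..<K} ({..<N} \<times> (UNIV :: 'd set))"
    using ex_bij_betw_nat_finite[of "{..<N} \<times> (UNIV :: 'd set)"]
    by (auto simp: K_def atLeast0LessThan)
  have "K \<ge> 1" using assms by (simp add: K_def card_cartesian_product Suc_le_eq)
  define W1 where "W1 j i = (if i = snd (\<phi> j) then 1 else 0 :: real)" for j i
  define b1 where "b1 j = - (a (fst (\<phi> j)) $ snd (\<phi> j))" for j
  define W2 where "W2 r j = (if fst (\<phi> j) = r then - c r else 0)" for r j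
  define g1 where "g1 x = relu (affine_map UNIV W1 b1 (\<lambda>i. x $ i))" for x :: "real ^ 'd"
  define g2 where "g2 x = relu (affine_map {..<K} W2 (\<lambda>r. 1) (g1 x))" for x :: "real ^ 'd"
  have "relu_hidden 1 K (K * CARD('d) + K) g1"
    unfolding g1_def[abs_def] by (rule relu_hidden.first[OF \<open>K \<ge> 1\<close>])
  then have "relu_hidden (Suc 1) N (K * CARD('d) + K + (N * K + N)) g2"
    unfolding g2_def[abs_def] by (rule relu_hidden.step[OF _ assms])
  then have net: "relu_hidden 2 N (K * CARD('d) + K + (N * K + N)) g2"
    by (simp add: numeral_2_eq_2)
  have g1: "g1 x j = max (x $ snd (\<phi> j) - a (fst (\<phi> j)) $ snd (\<phi> j)) 0" for x j
  proof -
    have "(\<Sum>i\<in>UNIV. W1 j i * x $ i) = (\<Sum>i\<in>UNIV. if i = snd (\<phi> j) then x $ i else 0)"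
      by (intro sum.cong) (auto simp: W1_def)
    then show ?thesis by (simp add: g1_def relu_def affine_map_def b1_def)
  qed
  have g2: "g2 x r = corner_bump (c r) (a r) x" if "r < N" for x r
  proof -
    have "(\<Sum>j<K. W2 r j * g1 x j) = (\<Sum>j<K. (\<lambda>(q, i).
        if q = r then - c r * max (x $ i - a q $ i) 0 else 0) (\<phi> j))"
      by (intro sum.cong) (auto simp: W2_def g1 split: prod.split)
    also have "\<dots> = (\<Sum>(q, i)\<in>{..<N} \<times> UNIV. if q = r then - c r * max (x $ i - a q $ i) 0 else 0)"
      by (rule sum.reindex_bij_betw[OF \<phi>])
    also have "\<dots> = (\<Sum>q<N. if q = r then \<Sum>i\<in>UNIV. - c r * max (x $ i - a q $ i) 0 else 0)"
      by (subst sum.cartesian_product[symmetric]) (rule sum.cong, auto)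
    also have "\<dots> = - c r * (\<Sum>i\<in>UNIV. max (x $ i - a r $ i) 0)"
      using that by (simp add: sum_distrib_left sum_negf)
    finally show ?thesis by (simp add: g2_def relu_def affine_map_def corner_bump_def)
  qed
  show ?thesis using net g2 by blast
qed

lemma bump_sum_relu_network:
  fixes ts :: "(real \<times> (real ^ 'd) \<times> (real ^ 'm)) list"
  assumes "2 \<le> L"
  shows "\<exists>n. relu_network L n (bump_sum ts)"
proof -
  \<comment> \<open>A layer has at least one neuron, so the empty combination needs a dummy bump with
    coefficient zero.\<close>
  define us where "us = (0, 0, 0) # ts"
  define N where "N = length us"
  have "N \<ge> 1" by (simp add: N_def us_def)
  obtain n g where g: "relu_hidden 2 N n g"
      "\<And>x r. r < N \<Longrightarrow> g x r = corner_bump (fst (us ! r)) (fst (snd (us ! r))) x"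
    using corner_bumps_relu_hidden[OF \<open>N \<ge> 1\<close>,
        of "\<lambda>r. fst (us ! r)" "\<lambda>r. fst (snd (us ! r))"] by blast
  obtain n' g' where g': "relu_hidden L N n' g'" "\<And>x r. r < N \<Longrightarrow> g' x r = g x r"
    using relu_hidden_deepen[OF g(1), of "L - 2"] unfolding le_add_diff_inverse[OF assms]
    by blast
  let ?W = "\<lambda>j r. snd (snd (us ! r)) $ j"
  have "bump_sum ts x = (\<chi> j. affine_map {..<N} ?W (\<lambda>j. 0) (g' x) j)" for x
  proof -
    have "bump_sum ts x = bump_sum us x" by (simp add: bump_sum_def us_def)
    also have "\<dots> = (\<Sum>r<N. corner_bump (fst (us ! r)) (fst (snd (us ! r))) x *\<^sub>R snd (snd (us ! r)))"
      by (simp add: bump_sum_def sum_list_sum_nth N_def atLeast0LessThan case_prod_beta)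
    also have "\<dots> = (\<chi> j. affine_map {..<N} ?W (\<lambda>j. 0) (g' x) j)"
      by (simp add: vec_eq_iff affine_map_def g'(2) g(2) mult.commute)
    finally show ?thesis .
  qed
  then show ?thesis unfolding relu_network_def using g'(1) by blast
qed

theorem theorem4p3:
  fixes \<eta> :: "(real ^ 'd) measure"
    and F :: "real ^ 'd \<Rightarrow> real ^ 'm"
    and p \<epsilon> :: real
  assumes "prob_space \<eta>" and "sets \<eta> = sets borel"
    and "1 \<le> p"
    and "F \<in> Lp_space p \<eta>"
    and "\<epsilon> > 0"
  shows "\<exists>(n :: nat) (F_hat :: real ^ 'd \<Rightarrow> real ^ 'm).
    relu_network 4 n F_hat \<and>
    (\<lambda>x. F x - F_hat x) \<in> Lp_space p \<eta> \<and>
    Lp_norm p \<eta> (\<lambda>x. F x - F_hat x) < \<epsilon>"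
proof -
  interpret prob_space \<eta> by fact
  have p: "0 < p" using assms(3) by simp
  have "F \<in> Lp_closure p \<eta> (range bump_sum)"
    using bump_sum_dense[OF finite_measure_axioms assms(2) p] assms(4) by blast
  \<comment> \<open>\<open>Lp_closure\<close> measures errors without the \<open>p\<close>-th root.\<close>
  moreover have "\<epsilon> powr p > 0" using assms(5) by simp
  ultimately obtain ts where ts: "(\<lambda>x. F x - bump_sum ts x) \<in> Lp_space p \<eta>"
      "(\<integral>x. norm (F x - bump_sum ts x) powr p \<partial>\<eta>) < \<epsilon> powr p"
    unfolding Lp_closure_def by blast
  have "Lp_norm p \<eta> (\<lambda>x. F x - bump_sum ts x) < (\<epsilon> powr p) powr (1 / p)"
    unfolding Lp_norm_def using p ts(2) by (intro powr_less_mono2) auto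
  also have "\<dots> = \<epsilon>" using p assms(5) by (simp add: powr_powr)
  finally have "Lp_norm p \<eta> (\<lambda>x. F x - bump_sum ts x) < \<epsilon>" .
  moreover obtain n where "relu_network 4 n (bump_sum ts)"
    using bump_sum_relu_network[of 4 ts] by auto
  ultimately show ?thesis using ts(1) by blast
qed

end
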